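(* Let $R$ be an associative ring with unity $1$, and let $p, q \in R$ be idempotents (i.e. $p^2=p$ and $q^2=q$). Then the following statements are equivalent: (1) $pq\in R^D$; (2) $1-p-q\in R^D$; (3) $(1-p)(1-q)\in R^D$.
   Context: An element $a\in R$ is Drazin invertible if there exists $b\in R$ such that $ab=ba$, $bab=b$, and $a^k=a^{k+1}b$ for some positive integer $k$; such $b$ is unique if it exists and is denoted $a^D$. $R^D$ denotes the set of all Drazin invertible elements of $R$. The ring $R$ is not assumed commutative. *)

theory Defs
  imports Main
begin

(* The sort {ring, monoid_mult} is that of associative, not necessarily commutative
   rings with unity; unlike the class ring_1 it does not require 0 \<noteq> 1. *)

definition is_drazin_inverse :: "'a::{ring,monoid_mult} \<Rightarrow> 'a \<Rightarrow> bool" where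
  "is_drazin_inverse a b \<longleftrightarrow>
     a * b = b * a \<and> b * a * b = b \<and> (\<exists>k::nat. k > 0 \<and> a ^ k = a ^ (k + 1) * b)"

definition drazin_invertible_elements :: "'a::{ring,monoid_mult} set" where
  "drazin_invertible_elements = {a. \<exists>b. is_drazin_inverse a b}"

end

theory Submission
  imports Defs
begin

text \<open>
  Put \<open>c = 1 - p - q\<close> and \<open>s = c\<^sup>2\<close>. Then \<open>s\<close> commutes with \<open>p\<close> and \<open>q\<close>, \<open>s p = p q p\<close> and
  \<open>s q = q p q\<close>, hence \<open>(p q) ^ (n + 1) = s ^ n p q\<close>. An element \<open>a\<close> is Drazin invertible iff some
  power \<open>a ^ n\<close> lies in both \<open>a ^ (n + 1) R\<close> and \<open>R a ^ (n + 1)\<close>, and this condition is easily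
  moved from \<open>c\<close> to \<open>s\<close> and then to \<open>p q\<close>. Conversely, the condition for \<open>p q\<close> places
  \<open>s ^ n p\<close> and \<open>s ^ n q\<close> in \<open>s ^ (n + 1) R\<close> for some \<open>n\<close>, so that \<open>s ^ n = s ^ n (c + p + q)\<close> lies
  in \<open>c ^ (2 n + 1) R\<close>, and likewise on the left. Replacing \<open>p\<close> and \<open>q\<close> by \<open>1 - p\<close> and \<open>1 - q\<close>
  turns \<open>c\<close> into \<open>-c\<close> and leaves \<open>s\<close> unchanged.
\<close>

text \<open>One exponent serves both sides, but \<open>x\<close> and \<open>y\<close> need not agree
  or commute with \<open>a\<close>, so each side can be treated separately. The case
  \<open>n = 0\<close> means that \<open>a\<close> is a unit.\<close>

definition strongly_pi_regular :: "'a::monoid_mult \<Rightarrow> bool" where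
  "strongly_pi_regular a \<longleftrightarrow> (\<exists>n x y. a ^ n = a ^ Suc n * x \<and> a ^ n = y * a ^ Suc n)"

lemma power_right_absorb:
  fixes a x :: "'a::monoid_mult"
  assumes "a ^ n = a ^ Suc n * x"
  shows "a ^ n = a ^ (n + m) * x ^ m"
proof (induction m)
  case (Suc m)
  have "a ^ (n + m) = a ^ m * a ^ n"
    by (simp add: power_add[symmetric] add.commute)
  also have "\<dots> = a ^ (n + Suc m) * x"
    by (subst assms) (simp add: power_add[symmetric] mult.assoc[symmetric] add.commute
        del: power_Suc)
  finally show ?case
    using Suc by (metis mult.assoc power_Suc)
qed simp

lemma power_left_absorb:
  fixes a y :: "'a::monoid_mult"
  assumes "a ^ n = y * a ^ Suc n"
  shows "a ^ n = y ^ m * a ^ (n + m)"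
proof (induction m)
  case (Suc m)
  have "a ^ (n + m) = a ^ n * a ^ m"
    by (simp add: power_add)
  also have "\<dots> = y * a ^ (n + Suc m)"
    by (subst assms) (simp add: power_add[symmetric] mult.assoc del: power_Suc)
  finally show ?case
    using Suc by (metis mult.assoc power_Suc2)
qed simp

text \<open>Iterating both equations keeps \<open>n\<close> fixed while \<open>m\<close> stays free,
  so the gain \<open>m\<close> may later be chosen depending on \<open>n\<close>.\<close>

lemma strongly_pi_regular_absorb:
  assumes "strongly_pi_regular a"
  obtains n where "\<And>m. \<exists>x. a ^ n = a ^ (n + m) * x" "\<And>m. \<exists>y. a ^ n = y * a ^ (n + m)"
  using assms unfolding strongly_pi_regular_def
  by (metis power_right_absorb power_left_absorb)

lemma strongly_pi_regular_if_drazin: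
  assumes "a \<in> drazin_invertible_elements"
  shows "strongly_pi_regular a"
proof -
  obtain b k where b: "a * b = b * a" "a ^ k = a ^ Suc k * b"
    using assms by (auto simp: drazin_invertible_elements_def is_drazin_inverse_def)
  have "a ^ Suc k * b = b * a ^ Suc k"
    using b(1) by (metis power_commuting_commutes)
  then show ?thesis
    unfolding strongly_pi_regular_def using b(2) by metis
qed

lemma drazin_if_strongly_pi_regular:
  fixes a :: "'a::{ring,monoid_mult}"
  assumes "strongly_pi_regular a"
  shows "a \<in> drazin_invertible_elements"
proof -
  obtain n where "\<exists>x. a ^ n = a ^ (n + Suc n) * x" "\<exists>y. a ^ n = y * a ^ (n + Suc n)"
    using strongly_pi_regular_absorb[OF assms] by metis
  then obtain x y where x: "a ^ n = a ^ (n + Suc n) * x" and y: "a ^ n = y * a ^ (n + Suc n)"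
    by blast
  \<comment> \<open>The Drazin inverse. Both \<open>a ^ n * x\<close> and \<open>y * a ^ n\<close>
    equal \<open>y * a ^ (2 * n + 1) * x\<close>, so \<open>b\<close> can be read from either
    side.\<close>
  define b where "b = a ^ n * x"
  have b: "b = y * a ^ n"
    unfolding b_def by (metis x y mult.assoc)
  have m: "a ^ (n + Suc n) = a ^ Suc n * a ^ n"
    by (simp only: power_add[symmetric] add.commute)
  have comm_m: "a * a ^ (n + Suc n) = a ^ (n + Suc n) * a"
    by (simp only: power_commutes)
  have ba: "b * a = y * a ^ Suc n"
    unfolding b by (simp only: mult.assoc power_Suc2)
  also have "\<dots> = y * (a * (a ^ (n + Suc n) * x))"
    by (simp only: x[symmetric] power_Suc)
  also have "\<dots> = y * a ^ (n + Suc n) * (a * x)"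
    by (metis mult.assoc comm_m)
  also have "\<dots> = a * b"
    by (metis y b_def mult.assoc power_commutes)
  finally have comm: "b * a = a * b" .
  have "b * a * b = y * a ^ (n + Suc n) * x"
    unfolding ba m by (simp only: b_def mult.assoc)
  then have bab: "b * a * b = b"
    by (simp only: y[symmetric] b_def)
  have "a ^ Suc n * b = a ^ n"
    unfolding b_def by (metis x m mult.assoc)
  \<comment> \<open>The extra factor \<open>a\<close> makes the exponent positive even when
    \<open>n = 0\<close>.\<close>
  then have "a ^ Suc n = a ^ (Suc n + 1) * b"
    by (simp add: mult.assoc)
  with comm bab have "is_drazin_inverse a b"
    unfolding is_drazin_inverse_def by (intro conjI exI[of _ "Suc n"]) simp_all
  then show ?thesis
    unfolding drazin_invertible_elements_def by blast
qed

lemma drazin_iff_strongly_pi_regular: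
  "a \<in> drazin_invertible_elements \<longleftrightarrow> strongly_pi_regular a"
  using strongly_pi_regular_if_drazin drazin_if_strongly_pi_regular by blast

lemma power_mult_self:
  fixes c :: "'a::monoid_mult"
  shows "(c * c) ^ m = c ^ (2 * m)"
  by (simp add: power_mult power2_eq_square)

lemma strongly_pi_regular_square_iff:
  "strongly_pi_regular (c * c) \<longleftrightarrow> strongly_pi_regular c"
proof
  assume "strongly_pi_regular (c * c)"
  then obtain n x y where x: "(c * c) ^ n = (c * c) ^ Suc n * x"
    and y: "(c * c) ^ n = y * (c * c) ^ Suc n"
    unfolding strongly_pi_regular_def by blast
  have right: "(c * c) ^ Suc n = c ^ Suc (2 * n) * c" and left: "(c * c) ^ Suc n = c * c ^ Suc (2 * n)"
    unfolding power_mult_self by (simp_all add: power_commutes mult.assoc)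
  have "c ^ (2 * n) = c ^ Suc (2 * n) * (c * x)"
    using x unfolding right by (simp only: power_mult_self mult.assoc)
  moreover have "c ^ (2 * n) = (y * c) * c ^ Suc (2 * n)"
    using y unfolding left by (simp only: power_mult_self mult.assoc)
  ultimately show "strongly_pi_regular c"
    unfolding strongly_pi_regular_def by blast
next
  assume "strongly_pi_regular c"
  \<comment> \<open>The gain \<open>n + 2\<close> turns \<open>c ^ n\<close> into a multiple of
    \<open>c ^ (2 * n + 2)\<close>, which is the power \<open>Suc n\<close> of
    \<open>c * c\<close>.\<close>
  then obtain n where "\<exists>x. c ^ n = c ^ (n + (n + 2)) * x" "\<exists>y. c ^ n = y * c ^ (n + (n + 2))"
    by (metis strongly_pi_regular_absorb)
  then obtain x y where x: "c ^ n = c ^ (n + (n + 2)) * x" and y: "c ^ n = y * c ^ (n + (n + 2))"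
    by blast
  have n: "(c * c) ^ n = c ^ n * c ^ n"
    by (simp only: power_mult_self mult_2 power_add)
  have Suc_n: "(c * c) ^ Suc n = c ^ (n + (n + 2))"
    by (simp add: power_mult_self mult_2 del: power_Suc)
  have "(c * c) ^ n = (c * c) ^ Suc n * (x * c ^ n)"
    unfolding n Suc_n by (metis x mult.assoc)
  moreover have "(c * c) ^ n = (c ^ n * y) * (c * c) ^ Suc n"
    unfolding n Suc_n by (metis y mult.assoc)
  ultimately show "strongly_pi_regular (c * c)"
    unfolding strongly_pi_regular_def by blast
qed

lemma strongly_pi_regular_idempotents_iff:
  fixes p q :: "'a::{ring,monoid_mult}"
  assumes pp: "p * p = p" and qq: "q * q = q" and c: "c = 1 - p - q"
  shows "strongly_pi_regular (p * q) \<longleftrightarrow> strongly_pi_regular (c * c)"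
proof -
  define s a where "s = c * c" and "a = p * q"
  have pp': "p * (p * z) = p * z" and qq': "q * (q * z) = q * z" for z
    by (simp_all add: mult.assoc[symmetric] pp qq)
  \<comment> \<open>Here \<open>a * p\<close> is \<open>p q p\<close> and \<open>q * a\<close> is
    \<open>q p q\<close>; each is symmetric, which makes \<open>s\<close> commute with
    \<open>p\<close> and \<open>q\<close>.\<close>
  have sp: "s * p = a * p" and ps: "p * s = a * p" and sq: "s * q = q * a" and qs: "q * s = q * a"
    unfolding s_def c a_def by (simp_all add: algebra_simps pp qq pp' qq')
  have comm_p: "s ^ n * p = p * s ^ n" and comm_q: "s ^ n * q = q * s ^ n"
    and comm_a: "s ^ n * a = a * s ^ n" for n
  proof -
    show p: "s ^ n * p = p * s ^ n" and q: "s ^ n * q = q * s ^ n"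
      using sp ps sq qs by (metis power_commuting_commutes)+
    show "s ^ n * a = a * s ^ n"
      unfolding a_def by (metis p q mult.assoc)
  qed
  \<comment> \<open>Indeed \<open>a * a = (a * p) * q = (s * p) * q\<close>.\<close>
  have aa: "a * a = s * a"
    unfolding a_def by (metis a_def sp mult.assoc)
  have pow_a: "a ^ Suc n = s ^ n * a" for n
  proof (induction n)
    case (Suc n)
    have "a ^ Suc (Suc n) = s ^ n * a * a"
      using Suc by (metis power_Suc2)
    also have "\<dots> = s ^ Suc n * a"
      by (metis aa mult.assoc power_Suc2)
    finally show ?case .
  qed simp
  show ?thesis
    unfolding s_def[symmetric] a_def[symmetric]
  proof
    assume "strongly_pi_regular s"
    then obtain n x y where x: "s ^ n = s ^ Suc n * x" and y: "s ^ n = y * s ^ Suc n"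
      unfolding strongly_pi_regular_def by blast
    have "a ^ Suc n = a ^ Suc (Suc n) * x"
      unfolding pow_a comm_a by (metis x mult.assoc)
    moreover have "a ^ Suc n = y * a ^ Suc (Suc n)"
      unfolding pow_a by (metis y mult.assoc)
    ultimately show "strongly_pi_regular a"
      unfolding strongly_pi_regular_def by blast
  next
    assume "strongly_pi_regular a"
    \<comment> \<open>A gain of two is needed, since one factor \<open>s\<close> is spent below when
      \<open>a\<close> is traded for \<open>p\<close> or \<open>q\<close>.\<close>
    then obtain n x y where "a ^ n = a ^ (n + 2) * x" "a ^ n = y * a ^ (n + 2)"
      by (metis strongly_pi_regular_absorb)
    then have "a ^ Suc n = a ^ Suc (n + 2) * x" "a ^ Suc n = y * a ^ Suc (n + 2)"
      by (metis power_Suc mult.assoc, metis power_Suc2 mult.assoc)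
    then have x: "s ^ n * a = s ^ (n + 2) * (a * x)" and y: "s ^ n * a = y * a * s ^ (n + 2)"
      unfolding pow_a by (metis mult.assoc, metis comm_a mult.assoc)
    \<comment> \<open>The trade: \<open>p\<close> on the right or \<open>q\<close> on the left of
      \<open>a\<close> turns \<open>a\<close> into \<open>s\<close>.\<close>
    have sn: "s ^ Suc n * p = s ^ n * a * p" "s ^ Suc n * q = q * (s ^ n * a)"
      by (metis sp mult.assoc power_Suc2, metis sq comm_q mult.assoc power_Suc2)
    have px: "s ^ Suc n * p = s ^ (n + 2) * (a * x * p)"
      unfolding sn x by (simp add: mult.assoc)
    have qx: "s ^ Suc n * q = s ^ (n + 2) * (q * a * x)"
      unfolding sn x by (metis comm_q mult.assoc)
    have py: "s ^ Suc n * p = y * a * p * s ^ (n + 2)"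
      unfolding sn y by (metis comm_p mult.assoc)
    have qy: "s ^ Suc n * q = q * y * a * s ^ (n + 2)"
      unfolding sn y by (simp add: mult.assoc)
    have split: "s ^ Suc n = s ^ Suc n * c + s ^ Suc n * p + s ^ Suc n * q"
      unfolding c by (simp add: distrib_left[symmetric])
    have s_pow: "s ^ m = c ^ (2 * m)" for m
      by (simp add: s_def power_mult_self)
    \<comment> \<open>The power \<open>s ^ (n + 2)\<close> is \<open>c ^ (2 * n + 4)\<close>, so it
      has a spare \<open>c\<close> to split off on either side; the term
      \<open>s ^ Suc n * c\<close> is exactly \<open>c ^ (2 * n + 3)\<close>.\<close>
    have c1: "s ^ (n + 2) = c ^ Suc (2 * Suc n) * c" "s ^ (n + 2) = c * c ^ Suc (2 * Suc n)"
      "s ^ Suc n * c = c ^ Suc (2 * Suc n)" "s ^ Suc n = c ^ (2 * Suc n)"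
      unfolding s_pow by (simp_all add: power_commutes mult.assoc)
    have "c ^ (2 * Suc n) = c ^ Suc (2 * Suc n) * (1 + c * (a * x * p) + c * (q * a * x))"
      using split unfolding px qx c1(3) unfolding c1(1,4) by (simp only: distrib_left mult.assoc mult_1_right)
    moreover have "c ^ (2 * Suc n) = (1 + y * a * p * c + q * y * a * c) * c ^ Suc (2 * Suc n)"
      using split unfolding py qy c1(3) unfolding c1(2,4) by (simp only: distrib_right mult.assoc mult_1_left)
    ultimately have "strongly_pi_regular c"
      unfolding strongly_pi_regular_def by blast
    then show "strongly_pi_regular s"
      unfolding s_def strongly_pi_regular_square_iff .
  qed
qed

theorem theorem3p4:
  fixes p q :: "'a::{ring,monoid_mult}"
  assumes "p ^ 2 = p" and "q ^ 2 = q"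
  shows "(p * q \<in> drazin_invertible_elements \<longleftrightarrow> 1 - p - q \<in> drazin_invertible_elements) \<and>
         (1 - p - q \<in> drazin_invertible_elements \<longleftrightarrow>
            (1 - p) * (1 - q) \<in> drazin_invertible_elements)"
proof -
  have p: "p * p = p" and q: "q * q = q"
    using assms by (simp_all add: power2_eq_square)
  have p': "(1 - p) * (1 - p) = 1 - p" and q': "(1 - q) * (1 - q) = 1 - q"
    by (simp_all add: algebra_simps p q)
  have "1 - (1 - p) - (1 - q) = - (1 - p - q)"
    by simp
  then have "(1 - (1 - p) - (1 - q)) * (1 - (1 - p) - (1 - q)) = (1 - p - q) * (1 - p - q)"
    by (simp only: minus_mult_minus)
  then show ?thesis
    unfolding drazin_iff_strongly_pi_regular
    using strongly_pi_regular_idempotents_iff[OF p q refl]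
      strongly_pi_regular_idempotents_iff[OF p' q' refl]
      strongly_pi_regular_square_iff[of "1 - p - q"]
    by simp
qed

end
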